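(* Let $\gamma_-$ and $\gamma_+$ be strictly convex, smooth loops in the plane. Then for each integer $k\ge2$ there exists a $2k$-periodic symplectic billiard trajectory on the phase space $\mathcal{P}(\gamma_-,\gamma_+)$.
   Context: Let $\gamma_-$ and $\gamma_+$ be smooth embedded loops in the plane each bounding a strictly convex domain. For $x\in\gamma_\pm$ let $\nu_x$ be the outer unit normal and $T_x\gamma_\pm\subset\mathbb{R}^2$ the (linear) tangent line. The notation $\gamma_\pm,\gamma_\mp$ indicates a choice of sign and its opposite. The phase space is $\mathcal{P}(\gamma_-,\gamma_+)=\{(x,y)\in(\gamma_-\times\gamma_+)\sqcup(\gamma_+\times\gamma_-)\mid\det(\nu_x,\nu_y)\neq0\}$. For $(x_0,x_1)\in\mathcal{P}(\gamma_-,\gamma_+)$ with $x_0\in\gamma_\pm$, $x_1\in\gamma_\mp$, let $x_2$ be the unique intersection point other than $x_0$ of $\gamma_\pm$ with the line $x_0+T_{x_1}\gamma_\mp$. The symplectic billiard map is $\phi(x_0,x_1)=(x_1,x_2)$; it maps $\mathcal{P}(\gamma_-,\gamma_+)$ into itself and is invertible there. The trajectory of $(x_0,x_1)$ is the sequence $(x_k)_{k\in\mathbb{Z}}$ with $\phi^k(x_0,x_1)=(x_k,x_{k+1})$. It is called $2k$-periodic if $\phi^{2k}(x_0,x_1)=(x_0,x_1)$; here $2k$ is not required to be the minimal period (the trajectory may be a multiple cover). *)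

theory Defs
  imports "HOL-Analysis.Analysis"
begin

definition smooth_curve :: "(real \<Rightarrow> real^2) \<Rightarrow> bool" where
  "smooth_curve c \<longleftrightarrow>
     (\<forall>n t. ((\<lambda>g u. vector_derivative g (at u)) ^^ n) c differentiable (at t))"

text \<open>A loop is a 1-periodic curve on the real line.  As the circle is compact, embedded means
  regular and injective modulo the period.\<close>

definition smooth_embedded_loop :: "(real \<Rightarrow> real^2) \<Rightarrow> bool" where
  "smooth_embedded_loop c \<longleftrightarrow>
     smooth_curve c \<and>
     (\<forall>t. vector_derivative c (at t) \<noteq> 0) \<and>
     (\<forall>s t. c s = c t \<longleftrightarrow> s - t \<in> \<int>)"

text \<open>Strict convexity only excludes segments in the boundary; for a loop bounding such a domain
  the curvature is allowed to vanish at some points.\<close>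

definition strictly_convex :: "(real^2) set \<Rightarrow> bool" where
  "strictly_convex S \<longleftrightarrow>
     (\<forall>x \<in> closure S. \<forall>y \<in> closure S. x \<noteq> y \<longrightarrow> open_segment x y \<subseteq> interior S)"

definition strictly_convex_smooth_loop :: "(real \<Rightarrow> real^2) \<Rightarrow> bool" where
  "strictly_convex_smooth_loop c \<longleftrightarrow>
     smooth_embedded_loop c \<and>
     (\<exists>D. open D \<and> connected D \<and> D \<noteq> {} \<and> bounded D \<and> frontier D = range c \<and> strictly_convex D)"

text \<open>The spanning set contains a single vector when \<open>x\<close> lies on an embedded loop.\<close>

definition tangent_line :: "(real \<Rightarrow> real^2) \<Rightarrow> real^2 \<Rightarrow> (real^2) set" where
  "tangent_line c x = span {vector_derivative c (at t) | t. c t = x}"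

text \<open>The unit normal pointing out of the bounded domain.  As the domain is convex, a normal points
  outwards precisely if the domain lies on the opposite side of the affine tangent line.\<close>

definition outer_unit_normal :: "(real \<Rightarrow> real^2) \<Rightarrow> real^2 \<Rightarrow> real^2" where
  "outer_unit_normal c x =
     (THE n. norm n = 1 \<and> (\<forall>v \<in> tangent_line c x. n \<bullet> v = 0) \<and>
             (\<forall>y \<in> inside (range c). n \<bullet> (y - x) < 0))"

text \<open>The two loops form a family indexed by a sign.  They may intersect or even coincide, so a
  point of the disjoint union of the two products carries the sign of the loop containing its
  first entry.\<close>

datatype sign = Minus | Plus

fun opposite :: "sign \<Rightarrow> sign" where
  "opposite Minus = Plus"
| "opposite Plus = Minus"

type_synonym state = "sign \<times> (real^2) \<times> (real^2)"

definition phase_space :: "(sign \<Rightarrow> real \<Rightarrow> real^2) \<Rightarrow> state set" where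
  "phase_space \<gamma> =
     {(s, x, y). x \<in> range (\<gamma> s) \<and> y \<in> range (\<gamma> (opposite s)) \<and>
        det (vector [outer_unit_normal (\<gamma> s) x, outer_unit_normal (\<gamma> (opposite s)) y] :: real^2^2)
          \<noteq> 0}"

text \<open>Only the values on the phase space are meaningful.\<close>

fun billiard_map :: "(sign \<Rightarrow> real \<Rightarrow> real^2) \<Rightarrow> state \<Rightarrow> state" where
  "billiard_map \<gamma> (s, x\<^sub>0, x\<^sub>1) =
     (opposite s, x\<^sub>1,
      THE x\<^sub>2. x\<^sub>2 \<in> range (\<gamma> s) \<inter> {x\<^sub>0 + v | v. v \<in> tangent_line (\<gamma> (opposite s)) x\<^sub>1} \<and> x\<^sub>2 \<noteq> x\<^sub>0)"

definition billiard_iterate :: "(sign \<Rightarrow> real \<Rightarrow> real^2) \<Rightarrow> int \<Rightarrow> state \<Rightarrow> state" where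
  "billiard_iterate \<gamma> k p =
     (if 0 \<le> k then (billiard_map \<gamma> ^^ nat k) p
      else (inv_into (phase_space \<gamma>) (billiard_map \<gamma>) ^^ nat (- k)) p)"

definition billiard_trajectory ::
    "(sign \<Rightarrow> real \<Rightarrow> real^2) \<Rightarrow> sign \<Rightarrow> (int \<Rightarrow> real^2) \<Rightarrow> bool" where
  "billiard_trajectory \<gamma> s x \<longleftrightarrow>
     (s, x 0, x 1) \<in> phase_space \<gamma> \<and>
     (\<forall>k. billiard_iterate \<gamma> k (s, x 0, x 1) =
            (if even k then s else opposite s, x k, x (k + 1)))"

definition periodic_billiard_trajectory ::
    "(sign \<Rightarrow> real \<Rightarrow> real^2) \<Rightarrow> int \<Rightarrow> sign \<Rightarrow> (int \<Rightarrow> real^2) \<Rightarrow> bool" where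
  "periodic_billiard_trajectory \<gamma> n s x \<longleftrightarrow>
     billiard_trajectory \<gamma> s x \<and> billiard_iterate \<gamma> n (s, x 0, x 1) = (s, x 0, x 1)"

end

theory Submission
  imports Defs
begin

text \<open>Maximise the sum of the values \<open>\<omega>(x\<^sub>i, x\<^sub>i\<^sub>+\<^sub>1)\<close> of the area form over closed \<open>2k\<close>-gons whose
  vertices lie alternately on the two loops.  Moving \<open>x\<^sub>i\<close> alone changes the sum by \<open>\<omega>(\<cdot>, x\<^sub>i\<^sub>+\<^sub>1 - x\<^sub>i\<^sub>-\<^sub>1)\<close>, so at a maximum
  \<open>x\<^sub>i\<^sub>+\<^sub>1 - x\<^sub>i\<^sub>-\<^sub>1\<close> is tangent at \<open>x\<^sub>i\<close>, which is the billiard law unless \<open>x\<^sub>i\<^sub>+\<^sub>1 = x\<^sub>i\<^sub>-\<^sub>1\<close>.  In that case the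
  sum does not depend on \<open>x\<^sub>i\<close>, so every point \<open>p\<close> of its loop can take its place in a maximum; as \<open>k \<ge> 2\<close>,
  the vertex \<open>x\<^sub>i\<^sub>+\<^sub>2\<close> stays fixed, and tangency of \<open>x\<^sub>i\<^sub>+\<^sub>2 - p\<close> at \<open>x\<^sub>i\<^sub>+\<^sub>1\<close> for all \<open>p\<close> would force the loop
  into a line.  Finally, a chord of a strictly convex loop is never tangent at its endpoint,
  so consecutive tangent lines are transversal.\<close>

section \<open>Linear algebra of the area form on the plane\<close>

definition area_form :: "real^2 \<Rightarrow> real^2 \<Rightarrow> real" where
  "area_form u v = u$1 * v$2 - u$2 * v$1"

lemma area_form_minus_right: "area_form u (v - w) = area_form u v - area_form u w"
  by (simp add: area_form_def algebra_simps)

lemma area_form_minus_left: "area_form (u - v) w = area_form u w - area_form v w"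
  by (simp add: area_form_def algebra_simps)

lemma area_form_swap: "area_form v u = - area_form u v"
  by (simp add: area_form_def)

lemma area_form_eq_inner: "area_form u w = vector [w$2, - w$1] \<bullet> u"
  by (simp add: area_form_def inner_vec_def sum_2)

lemma continuous_on_area_form [continuous_intros]:
  assumes "continuous_on S f" "continuous_on S g"
  shows "continuous_on S (\<lambda>x. area_form (f x) (g x))"
  unfolding area_form_def using assms by (intro continuous_intros)

lemma det_vector_2: "det (vector [u, v] :: real^2^2) = area_form u v"
  by (simp add: det_2 area_form_def)

lemma area_form_eq_0_iff:
  assumes "u \<noteq> 0"
  shows "area_form u v = 0 \<longleftrightarrow> v \<in> span {u}"
proof
  assume *: "area_form u v = 0"
  show "v \<in> span {u}"
  proof (cases "u$1 = 0")
    case True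
    with assms have "u$2 \<noteq> 0" by (simp add: vec_eq_iff forall_2)
    with True * have "v = (v$2 / u$2) *\<^sub>R u"
      by (auto simp: vec_eq_iff forall_2 area_form_def)
    then show ?thesis by (metis span_base span_scale singletonI)
  next
    case False
    with * have "v = (v$1 / u$1) *\<^sub>R u"
      by (auto simp: vec_eq_iff forall_2 area_form_def field_simps)
    then show ?thesis by (metis span_base span_scale singletonI)
  qed
qed (auto simp: span_singleton area_form_def)

text \<open>Both vectors lie on the line orthogonal to \<open>n\<close>. Eliminating between the two
  orthogonality relations shows that each coordinate of \<open>n\<close> annihilates the area
  form.\<close>

lemma orthogonal_imp_area_form_eq_0:
  assumes "n \<bullet> u = 0" "n \<bullet> v = 0" "n \<noteq> (0 :: real^2)"
  shows "area_form u v = 0"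
proof -
  have "n$1 * area_form u v = 0" "n$2 * area_form u v = 0"
    using assms(1,2) unfolding inner_vec_def sum_2 area_form_def by (simp; algebra)+
  with assms(3) show ?thesis by (auto simp: vec_eq_iff forall_2)
qed

text \<open>Normals are parallel exactly when the tangents are. This translates the phase space,
  which is defined by normals, into the velocities that occur in the billiard law.\<close>

lemma area_form_normals_eq_0_iff:
  assumes "n \<bullet> u = 0" "m \<bullet> v = 0" "n \<noteq> 0" "m \<noteq> 0" "u \<noteq> 0" "v \<noteq> 0"
  shows "area_form n m = 0 \<longleftrightarrow> area_form u v = 0"
proof
  assume "area_form n m = 0"
  then obtain a where "m = a *\<^sub>R n"
    using area_form_eq_0_iff[OF assms(3)] by (auto simp: span_singleton)
  with assms have "n \<bullet> v = 0" by auto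
  with assms show "area_form u v = 0" using orthogonal_imp_area_form_eq_0 by blast
next
  assume "area_form u v = 0"
  then obtain a where "v = a *\<^sub>R u"
    using area_form_eq_0_iff[OF assms(5)] by (auto simp: span_singleton)
  with assms have "u \<bullet> n = 0" "u \<bullet> m = 0" by (auto simp: inner_commute)
  with assms show "area_form n m = 0" using orthogonal_imp_area_form_eq_0 by blast
qed

section \<open>Extremal points and tangent lines of smooth loops\<close>

lemma inner_derivative_eq_0_at_max:
  fixes c :: "real \<Rightarrow> 'a::real_inner"
  assumes "(c has_vector_derivative c') (at t)" "\<And>s. a \<bullet> c s \<le> a \<bullet> c t"
  shows "a \<bullet> c' = 0"
proof -
  have "((\<lambda>s. a \<bullet> c s) has_vector_derivative a \<bullet> c') (at t)"
    using bounded_linear.has_vector_derivative[OF bounded_linear_inner_right assms(1)] .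
  then have "((\<lambda>s. a \<bullet> c s) has_real_derivative a \<bullet> c') (at t)"
    by (simp add: has_real_derivative_iff_has_vector_derivative)
  then show ?thesis
    using DERIV_local_max[of _ _ t 1] assms(2) by auto
qed

lemma smooth_embedded_loop_has_vector_derivative:
  assumes "smooth_embedded_loop c"
  shows "(c has_vector_derivative vector_derivative c (at t)) (at t)"
proof -
  have "((\<lambda>g u. vector_derivative g (at u)) ^^ 0) c differentiable (at t)"
    using assms unfolding smooth_embedded_loop_def smooth_curve_def by blast
  then show ?thesis by (simp add: vector_derivative_works)
qed

text \<open>By embeddedness \<open>s - t\<close> is an integer, so translating the parameter by it
  leaves \<open>c\<close> unchanged; the chain rule compares the velocities.\<close>

lemma smooth_embedded_loop_velocity_eq:
  assumes c: "smooth_embedded_loop c" and eq: "c s = c t"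
  shows "vector_derivative c (at s) = vector_derivative c (at t)"
proof -
  have per: "c a = c b \<longleftrightarrow> a - b \<in> \<int>" for a b
    using c by (simp add: smooth_embedded_loop_def)
  have "(c \<circ> (\<lambda>u. u + (s - t)) has_vector_derivative 1 *\<^sub>R vector_derivative c (at s)) (at t)"
    by (rule vector_diff_chain_at)
       (auto intro!: derivative_eq_intros simp: smooth_embedded_loop_has_vector_derivative[OF c])
  moreover have "c \<circ> (\<lambda>u. u + (s - t)) = c"
    using per eq by auto
  ultimately show ?thesis
    using smooth_embedded_loop_has_vector_derivative[OF c, of t]
    by (metis scaleR_one vector_derivative_at)
qed

lemma tangent_line_eq_span:
  assumes "smooth_embedded_loop c"
  shows "tangent_line c (c t) = span {vector_derivative c (at t)}"
proof -
  have "{vector_derivative c (at s) | s. c s = c t} = {vector_derivative c (at t)}"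
    using smooth_embedded_loop_velocity_eq[OF assms] by blast
  then show ?thesis by (simp add: tangent_line_def)
qed

section \<open>Geometry of a single strictly convex loop\<close>

locale convex_loop =
  fixes c :: "real \<Rightarrow> real^2"
  assumes loop: "strictly_convex_smooth_loop c"
begin

abbreviation velocity :: "real \<Rightarrow> real^2" where
  "velocity t \<equiv> vector_derivative c (at t)"

abbreviation D :: "(real^2) set" where
  "D \<equiv> inside (range c)"

lemma embedded: "smooth_embedded_loop c"
  using loop by (simp add: strictly_convex_smooth_loop_def)

lemma velocity_nonzero: "velocity t \<noteq> 0"
  using embedded by (simp add: smooth_embedded_loop_def)

lemmas has_velocity = smooth_embedded_loop_has_vector_derivative[OF embedded]

lemma tangent_line: "tangent_line c (c t) = span {velocity t}"
  by (rule tangent_line_eq_span[OF embedded])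

text \<open>The hypothesis only asserts that some domain \<open>E\<close> exists, whereas outer
  normals refer to \<open>inside (range c)\<close>. The two agree because strict convexity makes
  \<open>E\<close> convex, and the inside of the frontier of a bounded convex set is its
  interior.\<close>

lemma domain:
  shows open_domain: "open D" and convex_domain: "convex D" and bounded_domain: "bounded D"
    and domain_nonempty: "D \<noteq> {}" and frontier_domain: "frontier D = range c"
    and chord_in_domain: "\<And>p q. \<lbrakk>p \<in> range c; q \<in> range c; p \<noteq> q\<rbrakk> \<Longrightarrow> open_segment p q \<subseteq> D"
proof -
  obtain E where E: "open E" "E \<noteq> {}" "bounded E" "frontier E = range c" "strictly_convex E"
    using loop unfolding strictly_convex_smooth_loop_def by blast
  have seg: "open_segment p q \<subseteq> E" if "p \<in> closure E" "q \<in> closure E" "p \<noteq> q" for p q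
    using E(1,5) that by (simp add: strictly_convex_def interior_open)
  then have "convex E"
    unfolding convex_contains_open_segment using closure_subset by (metis subsetD empty_subsetI open_segment_idem)
  then have "D = E"
    using inside_frontier_eq_interior[of E] E by (simp add: interior_open)
  moreover have "open_segment p q \<subseteq> E" if "p \<in> range c" "q \<in> range c" "p \<noteq> q" for p q
    using seg that E(4) by (metis DiffE frontier_def)
  ultimately show "open D" "convex D" "bounded D" "D \<noteq> {}" "frontier D = range c"
    "\<And>p q. \<lbrakk>p \<in> range c; q \<in> range c; p \<noteq> q\<rbrakk> \<Longrightarrow> open_segment p q \<subseteq> D"
    using E \<open>convex E\<close> by simp_all
qed

lemma range_disjoint_domain: "range c \<inter> D = {}"
  using frontier_domain open_domain by (metis frontier_disjoint_eq)

lemma compact_range: "compact (range c)"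
  using compact_frontier_bounded[OF bounded_domain] by (simp add: frontier_domain)

text \<open>Of three distinct collinear points one lies strictly between the others, hence in the
  open domain, which is disjoint from the loop.\<close>

lemma no_three_collinear:
  assumes "p \<in> range c" "q \<in> range c" "r \<in> range c" "collinear {p, q, r}"
  shows "p = q \<or> q = r \<or> r = p"
proof (rule ccontr)
  assume "\<not> ?thesis"
  then have ne: "p \<noteq> q" "q \<noteq> r" "r \<noteq> p" by auto
  have "p \<in> closed_segment q r \<or> q \<in> closed_segment r p \<or> r \<in> closed_segment p q"
    using assms(4) by (simp only: collinear_between_cases between_mem_segment)
  then have "p \<in> open_segment q r \<or> q \<in> open_segment r p \<or> r \<in> open_segment p q"
    by (elim disjE) (simp_all add: open_segment_def ne ne[symmetric])
  then show False
    using chord_in_domain[OF assms(2,3) ne(2)] chord_in_domain[OF assms(3,1) ne(3)]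
      chord_in_domain[OF assms(1,2) ne(1)] assms(1-3) range_disjoint_domain
    by (metis disjoint_iff subsetD)
qed

lemma range_not_in_line: "\<exists>p \<in> range c. p - z \<notin> span {u}"
proof (rule ccontr)
  assume "\<not> ?thesis"
  then have line: "c t - z \<in> span {u}" for t by auto
  have "\<exists>k. c t = z + k *\<^sub>R u" for t
    using line[of t] by (auto simp: span_singleton algebra_simps)
  \<comment> \<open>The parameters 0, 1/3 and 2/3 are pairwise distinct modulo the period, so they
    give three distinct points of the loop.\<close>
  then have "collinear {c 0, c (1/3), c (2/3)}"
    unfolding collinear_alt by (metis insertE singletonD)
  then have "c (1/3) = c 0 \<or> c (2/3) = c (1/3) \<or> c (2/3) = c 0"
    using no_three_collinear by (metis rangeI)
  moreover have "(1/3 :: real) \<notin> \<int>" "(2/3 :: real) \<notin> \<int>"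
    using frac_eq_0_iff[of "1/3 :: real"] frac_eq_0_iff[of "2/3 :: real"]
    by (simp_all add: frac_eq_id)
  ultimately show False
    using embedded unfolding smooth_embedded_loop_def by simp
qed

text \<open>The loop lies in the closure of the domain, so the linear functional given by
  \<open>a\<close> is maximal along the loop at parameter \<open>t\<close>.\<close>

lemma supporting_normal_orthogonal:
  assumes "\<forall>y \<in> D. a \<bullet> (y - c t) \<le> 0"
  shows "a \<bullet> velocity t = 0"
proof (rule inner_derivative_eq_0_at_max[OF has_velocity])
  fix s
  have "closure D \<subseteq> {y. a \<bullet> y \<le> a \<bullet> c t}"
    using assms by (intro closure_minimal closed_halfspace_le) (auto simp: inner_diff_right)
  moreover have "c s \<in> closure D"
    using frontier_domain by (auto simp: frontier_def)
  ultimately show "a \<bullet> c s \<le> a \<bullet> c t" by auto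
qed

text \<open>Separate the domain from the line. A functional bounded below on the line has slope zero
  along it, and the inequality on the domain is strict because the domain is open.\<close>

lemma supporting_line_missing_domain:
  assumes "\<And>r. c t + r *\<^sub>R v \<notin> D"
  obtains a where "a \<noteq> 0" "a \<bullet> v = 0" "a \<bullet> velocity t = 0" "\<forall>y \<in> D. a \<bullet> (y - c t) < 0"
proof -
  let ?L = "range (\<lambda>r. c t + r *\<^sub>R v)"
  have "?L = (+) (c t) ` span {v}"
    by (auto simp: span_singleton)
  then have "convex ?L"
    by (metis convex_translation subspace_imp_convex subspace_span)
  then obtain a b where a: "a \<noteq> 0" and D: "\<And>x. x \<in> D \<Longrightarrow> a \<bullet> x \<le> b" and L: "\<And>x. x \<in> ?L \<Longrightarrow> b \<le> a \<bullet> x"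
    using separating_hyperplane_sets[OF convex_domain, of ?L] domain_nonempty assms by blast
  have L': "b \<le> a \<bullet> c t + r * (a \<bullet> v)" for r
    using L[of "c t + r *\<^sub>R v"] by (auto simp: inner_add_right)
  have av: "a \<bullet> v = 0"
  proof (rule ccontr)
    assume "a \<bullet> v \<noteq> 0"
    then show False using L'[of "(b - 1 - a \<bullet> c t) / (a \<bullet> v)"] by auto
  qed
  have strict: "a \<bullet> (y - c t) < 0" if y: "y \<in> D" for y
  proof -
    obtain e where e: "e > 0" "ball y e \<subseteq> D"
      using open_domain y open_contains_ball by blast
    \<comment> \<open>Moving from \<open>y\<close> by half the radius in direction \<open>a\<close>
      stays in the domain and strictly increases the functional.\<close>
    define z where "z = y + (e / (2 * norm a)) *\<^sub>R a"
    have "z \<in> D" using e a by (intro subsetD[OF e(2)]) (auto simp: z_def dist_norm)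
    then have "a \<bullet> z \<le> a \<bullet> c t" using D L'[of 0] by fastforce
    moreover have "a \<bullet> z > a \<bullet> y" using e a by (simp add: z_def inner_add_right)
    ultimately show ?thesis by (simp add: inner_diff_right)
  qed
  with a av show thesis
    using supporting_normal_orthogonal that by (meson less_imp_le)
qed

text \<open>Justifies the definite description. In the plane, two normals to the same tangent are
  proportional; having the domain on the negative side makes the factor positive, and unit length
  makes it 1.\<close>

lemma outer_unit_normal:
  shows outer_unit_normal_nonzero: "outer_unit_normal c (c t) \<noteq> 0"
    and outer_unit_normal_orthogonal: "outer_unit_normal c (c t) \<bullet> velocity t = 0"
    and outer_unit_normal_supporting: "\<forall>y \<in> D. outer_unit_normal c (c t) \<bullet> (y - c t) < 0"
proof -
  define P where "P = (\<lambda>n. norm n = 1 \<and> (\<forall>v \<in> tangent_line c (c t). n \<bullet> v = 0) \<and>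
             (\<forall>y \<in> D. n \<bullet> (y - c t) < 0))"
  \<comment> \<open>Direction 0 shrinks the line to the point \<open>c t\<close>, so the separation
    lemma yields a supporting normal there.\<close>
  have "c t + r *\<^sub>R 0 \<notin> D" for r
    using range_disjoint_domain by auto
  then obtain a where a: "a \<noteq> 0" "a \<bullet> velocity t = 0" "\<forall>y \<in> D. a \<bullet> (y - c t) < 0"
    using supporting_line_missing_domain by metis
  have "P (sgn a)"
    using a unfolding P_def tangent_line
    by (auto simp: span_singleton norm_sgn sgn_div_norm divide_simps)
  moreover have "n = sgn a" if "P n" for n
  proof -
    have n: "norm n = 1" "n \<bullet> velocity t = 0" "\<forall>y \<in> D. n \<bullet> (y - c t) < 0"
      using that span_base unfolding P_def tangent_line by auto
    then have "velocity t \<bullet> a = 0" "velocity t \<bullet> n = 0"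
      using a by (auto simp: inner_commute)
    then have "area_form a n = 0"
      using orthogonal_imp_area_form_eq_0 velocity_nonzero by blast
    then obtain r where r: "n = r *\<^sub>R a"
      using area_form_eq_0_iff[OF a(1)] by (auto simp: span_singleton)
    obtain y where "y \<in> D" using domain_nonempty by blast
    then have "r * (a \<bullet> (y - c t)) < 0" "a \<bullet> (y - c t) < 0"
      using n(3) a(3) by (auto simp: r)
    then have "r > 0" by (simp add: mult_less_0_iff)
    with r n(1) have "sgn n = sgn a" by (simp add: sgn_scaleR)
    with n(1) show ?thesis by (simp add: sgn_div_norm)
  qed
  ultimately have "P (outer_unit_normal c (c t))"
    unfolding outer_unit_normal_def P_def[symmetric] by (metis theI)
  then show "outer_unit_normal c (c t) \<noteq> 0" "outer_unit_normal c (c t) \<bullet> velocity t = 0"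
    "\<forall>y \<in> D. outer_unit_normal c (c t) \<bullet> (y - c t) < 0"
    using span_base unfolding P_def tangent_line by auto
qed

text \<open>The midpoint of the chord is in the domain, where the outer normal is strictly negative;
  on the tangent line it would vanish.\<close>

lemma chord_not_tangent:
  assumes "p \<in> range c" "p \<noteq> c t"
  shows "p - c t \<notin> span {velocity t}"
proof
  assume "p - c t \<in> span {velocity t}"
  then have 0: "outer_unit_normal c (c t) \<bullet> (p - c t) = 0"
    using outer_unit_normal_orthogonal by (auto simp: span_singleton)
  have "midpoint (c t) p \<in> D"
    using chord_in_domain[of "c t" p] assms by auto
  then have "outer_unit_normal c (c t) \<bullet> (midpoint (c t) p - c t) < 0"
    using outer_unit_normal_supporting by blast
  moreover have "midpoint (c t) p - c t = (1/2) *\<^sub>R (p - c t)"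
    by (simp add: midpoint_def algebra_simps flip: scaleR_left_distrib)
  ultimately show False using 0 by simp
qed

lemma transversal_line_second_point:
  assumes "area_form (velocity t) v \<noteq> 0"
  obtains r where "r \<noteq> 0" "c t + r *\<^sub>R v \<in> range c"
proof -
  \<comment> \<open>A line through \<open>c t\<close> missing \<open>D\<close> is a supporting line, and by smoothness the tangent is the only one.\<close>
  have "\<exists>r. c t + r *\<^sub>R v \<in> D"
  proof (rule ccontr)
    assume "\<not> ?thesis"
    then obtain a where "a \<noteq> 0" "a \<bullet> v = 0" "a \<bullet> velocity t = 0"
      using supporting_line_missing_domain by metis
    with assms show False using orthogonal_imp_area_form_eq_0 by blast
  qed
  then obtain r where r: "c t + r *\<^sub>R v \<in> D" by blast
  have "r *\<^sub>R v \<noteq> 0"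
    using r range_disjoint_domain by (metis add.right_neutral disjoint_iff rangeI)
  \<comment> \<open>The ray leaves the interior point in the direction away from \<open>c t\<close>.
    Its exit point has parameter \<open>(1 + d) * r\<close>, which is nonzero, so it differs from
    \<open>c t\<close>.\<close>
  then obtain d where d: "0 < d" "c t + r *\<^sub>R v + d *\<^sub>R (r *\<^sub>R v) \<in> frontier D"
    using ray_to_frontier[OF bounded_domain] r open_domain by (metis interior_open)
  have "r + d * r = (1 + d) * r" by (simp add: algebra_simps)
  then have "r + d * r \<noteq> 0" using d(1) \<open>r *\<^sub>R v \<noteq> 0\<close> by auto
  moreover have "c t + (r + d * r) *\<^sub>R v \<in> range c"
    using d(2) by (simp add: frontier_domain algebra_simps)
  ultimately show thesis using that by blast
qed


lemma second_point_unique: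
  assumes "x \<in> range c" "y \<in> range c" "z \<in> range c" "y \<noteq> x" "z \<noteq> x"
    and "y - x \<in> span {v}" "z - x \<in> span {v}"
  shows "y = z"
proof -
  obtain a b where "y - x = a *\<^sub>R v" "z - x = b *\<^sub>R v"
    using assms(6,7) unfolding span_singleton by blast
  then have "y = x + a *\<^sub>R v" "z = x + b *\<^sub>R v"
    by (metis add.commute diff_add_cancel)+
  moreover have "x = x + 0 *\<^sub>R v" by simp
  ultimately have "collinear {x, y, z}"
    unfolding collinear_alt by (metis insertE singletonD)
  then show ?thesis
    using no_three_collinear[OF assms(1-3)] assms(4,5) by metis
qed

end

section \<open>The billiard map of two loops and its injectivity\<close>

locale convex_loops =
  fixes \<gamma> :: "sign \<Rightarrow> real \<Rightarrow> real^2"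
  assumes loops: "\<And>s. strictly_convex_smooth_loop (\<gamma> s)"
begin

sublocale side: convex_loop "\<gamma> s" for s
  by unfold_locales (rule loops)

lemma phase_space_iff:
  "(s, \<gamma> s t, \<gamma> (opposite s) u) \<in> phase_space \<gamma> \<longleftrightarrow>
    area_form (side.velocity s t) (side.velocity (opposite s) u) \<noteq> 0"
  unfolding phase_space_def
  by (simp add: det_vector_2 area_form_normals_eq_0_iff[OF side.outer_unit_normal_orthogonal
      side.outer_unit_normal_orthogonal side.outer_unit_normal_nonzero
      side.outer_unit_normal_nonzero side.velocity_nonzero side.velocity_nonzero])

lemma billiard_map_eqI:
  assumes "x\<^sub>0 \<in> range (\<gamma> s)" "x\<^sub>1 \<in> range (\<gamma> (opposite s))" "x\<^sub>2 \<in> range (\<gamma> s)" "x\<^sub>2 \<noteq> x\<^sub>0"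
    and "x\<^sub>2 - x\<^sub>0 \<in> tangent_line (\<gamma> (opposite s)) x\<^sub>1"
  shows "billiard_map \<gamma> (s, x\<^sub>0, x\<^sub>1) = (opposite s, x\<^sub>1, x\<^sub>2)"
proof -
  obtain u where u: "x\<^sub>1 = \<gamma> (opposite s) u" using assms(2) by auto
  have "(THE x. x \<in> range (\<gamma> s) \<inter> {x\<^sub>0 + v | v. v \<in> tangent_line (\<gamma> (opposite s)) x\<^sub>1} \<and> x \<noteq> x\<^sub>0) = x\<^sub>2"
  proof (rule the_equality, goal_cases)
    case 1
    have "x\<^sub>2 = x\<^sub>0 + (x\<^sub>2 - x\<^sub>0)" by simp
    with assms show ?case by blast
  next
    case (2 x)
    then have "x - x\<^sub>0 \<in> tangent_line (\<gamma> (opposite s)) x\<^sub>1" by auto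
    with 2 assms show ?case
      using side.second_point_unique[of x\<^sub>0 s x x\<^sub>2] unfolding u side.tangent_line by blast
  qed
  then show ?thesis by simp
qed

text \<open>Needed because backward iterates are defined through \<open>inv_into\<close>.\<close>

lemma inj_on_billiard_map: "inj_on (billiard_map \<gamma>) (phase_space \<gamma>)"
proof (rule inj_onI)
  fix p q assume p: "p \<in> phase_space \<gamma>" and q: "q \<in> phase_space \<gamma>"
    and eq: "billiard_map \<gamma> p = billiard_map \<gamma> q"
  \<comment> \<open>On the phase space transversality provides a second intersection point, so the
    definite description in \<open>billiard_map\<close> denotes a genuine point.\<close>
  have map: "\<exists>x\<^sub>2 \<in> range (\<gamma> s). x\<^sub>2 \<noteq> \<gamma> s t \<and> x\<^sub>2 - \<gamma> s t \<in> span {side.velocity (opposite s) u} \<and>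
      billiard_map \<gamma> (s, \<gamma> s t, \<gamma> (opposite s) u) = (opposite s, \<gamma> (opposite s) u, x\<^sub>2)"
    if "(s, \<gamma> s t, \<gamma> (opposite s) u) \<in> phase_space \<gamma>" for s t u
  proof -
    let ?v = "side.velocity (opposite s) u"
    have "area_form (side.velocity s t) ?v \<noteq> 0"
      using that unfolding phase_space_iff .
    then obtain r where r: "r \<noteq> 0" "\<gamma> s t + r *\<^sub>R ?v \<in> range (\<gamma> s)"
      by (rule side.transversal_line_second_point)
    have "\<gamma> s t + r *\<^sub>R ?v \<noteq> \<gamma> s t" using r(1) side.velocity_nonzero by simp
    moreover have "\<gamma> s t + r *\<^sub>R ?v - \<gamma> s t \<in> span {?v}" by (simp add: span_base span_scale)
    ultimately show ?thesis
      using billiard_map_eqI r(2) side.tangent_line by (metis rangeI)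
  qed
  obtain s t u where p': "p = (s, \<gamma> s t, \<gamma> (opposite s) u)"
    using p by (auto simp: phase_space_def)
  obtain s' t' u' where q': "q = (s', \<gamma> s' t', \<gamma> (opposite s') u')"
    using q by (auto simp: phase_space_def)
  have "opposite s = opposite s'" using eq p' q' by simp
  then have s: "s' = s" by (cases s; cases s') auto
  have u: "\<gamma> (opposite s) u' = \<gamma> (opposite s) u" using eq p' q' s by simp
  with q' s have q'': "q = (s, \<gamma> s t', \<gamma> (opposite s) u)" by simp
  obtain z where z: "z \<in> range (\<gamma> s)" "z \<noteq> \<gamma> s t" "z - \<gamma> s t \<in> span {side.velocity (opposite s) u}"
    "billiard_map \<gamma> p = (opposite s, \<gamma> (opposite s) u, z)"
    using map p unfolding p' by blast
  obtain z' where z': "z' \<noteq> \<gamma> s t'" "z' - \<gamma> s t' \<in> span {side.velocity (opposite s) u}"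
    "billiard_map \<gamma> q = (opposite s, \<gamma> (opposite s) u, z')"
    using map q unfolding q'' by blast
  have "z' = z" using z(4) z'(3) eq by simp
  \<comment> \<open>Reversibility: the image determines the line through \<open>z\<close> parallel
    to the tangent at the middle point, and the initial point is the only other point of the loop on
    that line.\<close>
  with z z' have "\<gamma> s t - z \<in> span {side.velocity (opposite s) u}"
      "\<gamma> s t' - z \<in> span {side.velocity (opposite s) u}" "\<gamma> s t \<noteq> z" "\<gamma> s t' \<noteq> z"
    by (metis minus_diff_eq span_neg)+
  then have "\<gamma> s t = \<gamma> s t'"
    by (intro side.second_point_unique[of z s]) (use z(1) in auto)
  then show "p = q" using p' q'' by simp
qed

end

section \<open>From alternating polygons to billiard trajectories\<close>

definition side_of :: "int \<Rightarrow> sign" where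
  "side_of i = (if even i then Minus else Plus)"

lemma opposite_side_of [simp]: "opposite (side_of i) = side_of (i + 1)"
  by (simp add: side_of_def)

lemma side_of_add_2 [simp]: "side_of (i + 2) = side_of i"
  by (simp add: side_of_def)

context convex_loops
begin

text \<open>If the tangents at \<open>x i\<close> and \<open>x (i + 1)\<close> were parallel, the
  chord from \<open>x (i - 1)\<close> to \<open>x (i + 1)\<close> would be tangent at its own
  endpoint \<open>x (i + 1)\<close>. Hence all consecutive pairs lie in the phase space.\<close>

lemma billiard_trajectoryI:
  assumes on: "\<And>i. x i \<in> range (\<gamma> (side_of i))"
    and neq: "\<And>i. x (i + 1) \<noteq> x (i - 1)"
    and tangent: "\<And>i. x (i + 1) - x (i - 1) \<in> tangent_line (\<gamma> (side_of i)) (x i)"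
  shows "billiard_trajectory \<gamma> Minus x"
proof -
  define z where "z i = (side_of i, x i, x (i + 1))" for i
  have phase: "z i \<in> phase_space \<gamma>" for i
  proof -
    obtain t where t: "x i = \<gamma> (side_of i) t" using on by blast
    obtain u where u: "x (i + 1) = \<gamma> (opposite (side_of i)) u" using on[of "i + 1"] by auto
    let ?v = "side.velocity (side_of i) t" and ?w = "side.velocity (opposite (side_of i)) u"
    let ?d = "x (i + 1) - x (i - 1)"
    have "x (i - 1) \<in> range (\<gamma> (opposite (side_of i)))"
      using on[of "i - 1"] by (cases "even i") (simp_all add: side_of_def)
    then have "x (i - 1) - x (i + 1) \<notin> span {?w}"
      using side.chord_not_tangent neq u by metis
    then have "?d \<notin> span {?w}"
      by (metis minus_diff_eq span_neg)
    moreover obtain r where r: "?d = r *\<^sub>R ?v"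
      using tangent[of i] unfolding t side.tangent_line by (auto simp: span_singleton)
    ultimately have "?v \<notin> span {?w}"
      using span_scale by metis
    then have "area_form ?w ?v \<noteq> 0"
      using area_form_eq_0_iff side.velocity_nonzero by blast
    then have "area_form ?v ?w \<noteq> 0"
      by (metis area_form_swap neg_equal_0_iff_equal)
    then show ?thesis
      unfolding z_def t u phase_space_iff .
  qed
  have step: "billiard_map \<gamma> (z i) = z (i + 1)" for i
  proof -
    have "billiard_map \<gamma> (side_of i, x i, x (i + 1)) = (opposite (side_of i), x (i + 1), x (i + 2))"
      using on[of i] on[of "i + 1"] on[of "i + 2"] neq[of "i + 1"] tangent[of "i + 1"]
      by (intro billiard_map_eqI) (simp_all add: add.assoc)
    then show ?thesis by (simp add: z_def add.assoc del: billiard_map.simps)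
  qed
  \<comment> \<open>Since every \<open>z i\<close> lies in the phase space, injectivity makes
    \<open>inv_into\<close> the true inverse along this orbit.\<close>
  have step_back: "inv_into (phase_space \<gamma>) (billiard_map \<gamma>) (z i) = z (i - 1)" for i
    using inv_into_f_f[OF inj_on_billiard_map phase[of "i - 1"]] step[of "i - 1"] by simp
  have forward_iterate: "(billiard_map \<gamma> ^^ n) (z 0) = z (int n)" for n
    by (induction n) (simp_all add: step add.commute)
  have backward_iterate:
    "(inv_into (phase_space \<gamma>) (billiard_map \<gamma>) ^^ n) (z 0) = z (- int n)" for n
  proof (induction n)
    case (Suc n)
    have "- int (Suc n) = - int n - 1" by simp
    with Suc show ?case by (simp only: funpow.simps comp_apply step_back)
  qed simp
  have "billiard_iterate \<gamma> i (z 0) = z i" for i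
    unfolding billiard_iterate_def using forward_iterate[of "nat i"] backward_iterate[of "nat (- i)"] by simp
  then show ?thesis
    using phase[of 0] unfolding billiard_trajectory_def z_def
    by (simp add: side_of_def)
qed

end

section \<open>Maximal closed polygons\<close>

lemma sum_area_form_update:
  fixes x :: "'i \<Rightarrow> real^2"
  assumes "finite I" "j \<in> I" "i \<in> I" "i \<noteq> j" "succ i = j" "succ j \<noteq> j"
    and inj: "\<And>k. \<lbrakk>k \<in> I; k \<noteq> i\<rbrakk> \<Longrightarrow> succ k \<noteq> j"
  shows "(\<Sum>k\<in>I. area_form ((x(j := y)) k) ((x(j := y)) (succ k))) =
    (\<Sum>k\<in>I. area_form (x k) (x (succ k))) + area_form (y - x j) (x (succ j) - x i)"
proof -
  \<comment> \<open>Only the terms of index \<open>i\<close> and \<open>j\<close> involve the vertex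
    \<open>x j\<close>. Antisymmetry merges their changes into a single area form that is linear in
    \<open>y - x j\<close>.\<close>
  have split: "(\<Sum>k\<in>I. f k) = f j + (f i + (\<Sum>k\<in>I - {j} - {i}. f k))" for f :: "'i \<Rightarrow> real"
    using assms(1-4) by (simp add: sum.remove[of I j] sum.remove[of "I - {j}" i])
  have "(\<Sum>k\<in>I - {j} - {i}. area_form ((x(j := y)) k) ((x(j := y)) (succ k))) =
      (\<Sum>k\<in>I - {j} - {i}. area_form (x k) (x (succ k)))"
    using inj by (intro sum.cong) auto
  then show ?thesis
    unfolding split using assms(4-6)
    by (simp add: area_form_minus_left area_form_minus_right area_form_swap[of _ "x i"])
qed

text \<open>Tychonoff's theorem, in the form used for polygons stored as functions on all
  integers.\<close>

lemma compact_PiE_UNIV: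
  fixes C :: "'i \<Rightarrow> 'a::topological_space set"
  assumes "\<And>i. compact (C i)"
  shows "compact (PiE UNIV C)"
proof -
  have "compactin (product_topology (\<lambda>i. euclidean) UNIV) (PiE UNIV C)"
    using assms by (simp add: compactin_PiE)
  then show ?thesis by (simp add: euclidean_product_topology)
qed

context convex_loops
begin

lemma exists_closed_polygon:
  fixes k :: int
  assumes k: "k \<ge> 2"
  obtains x where "\<And>i. x (i + 2 * k) = x i"
    and "\<And>i. x i \<in> range (\<gamma> (side_of i))"
    and "\<And>i. x (i + 1) \<noteq> x (i - 1)"
    and "\<And>i. x (i + 1) - x (i - 1) \<in> tangent_line (\<gamma> (side_of i)) (x i)"
proof -
  define n where "n = 2 * k"
  define succ where "succ i = (i + 1) mod n" for i
  define pred where "pred i = (i - 1) mod n" for i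
  define I where "I = {0..<n}"
  define C where "C i = range (\<gamma> (side_of i))" for i
  \<comment> \<open>As \<open>succ\<close> maps \<open>I\<close> into itself, \<open>F\<close>
    depends only on the coordinates in \<open>I\<close>. The remaining coordinates range freely over
    the compact product and are discarded when the maximiser is extended periodically.\<close>
  define F where "F x = (\<Sum>i\<in>I. area_form (x i) (x (succ i)))" for x :: "int \<Rightarrow> real^2"
  define maximal where "maximal x \<longleftrightarrow> x \<in> PiE UNIV C \<and> (\<forall>y \<in> PiE UNIV C. F y \<le> F x)" for x
  have n: "n \<ge> 4" "even n" using k by (auto simp: n_def)
  have succ_eq: "succ j = (if j + 1 = n then 0 else j + 1)"
    and pred_eq: "pred j = (if j = 0 then n - 1 else j - 1)" if "j \<in> I" for j
    using that n zmod_minus1[of n] by (auto simp: succ_def pred_def I_def)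

  have update: "F (x(j := y)) = F x + area_form (y - x j) (x (succ j) - x (pred j))" if "j \<in> I" for x j y
    unfolding F_def
  proof (rule sum_area_form_update[OF _ that])
    show j: "pred j \<in> I" "pred j \<noteq> j" "finite I" "succ j \<noteq> j"
      using that n by (auto simp: succ_eq pred_eq) (auto simp: I_def)
    show "succ (pred j) = j"
      using that n by (subst succ_eq[OF j(1)]) (auto simp: pred_eq I_def)
    show "succ i \<noteq> j" if i: "i \<in> I" "i \<noteq> pred j" for i
      using i \<open>j \<in> I\<close> n by (auto simp: succ_eq pred_eq) (auto simp: I_def split: if_splits)
  qed

  have on: "x i \<in> range (\<gamma> (side_of i))" if "maximal x" for x i
    using that by (simp add: maximal_def C_def PiE_iff)

  have critical: "x (succ j) - x (pred j) \<in> tangent_line (\<gamma> (side_of j)) (x j)"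
    if x: "maximal x" and j: "j \<in> I" for x j
  proof -
    obtain t where t: "x j = \<gamma> (side_of j) t"
      using on[OF x] by blast
    let ?w = "x (succ j) - x (pred j)" and ?v = "side.velocity (side_of j) t"
    \<comment> \<open>By \<open>update\<close>, \<open>F\<close> is affine in the vertex
      \<open>x j\<close> with linear part \<open>area_form _ ?w\<close>. Written as an inner
      product, this functional is maximal along the loop at \<open>t\<close>.\<close>
    have "area_form ?v ?w = 0"
      unfolding area_form_eq_inner
    proof (rule inner_derivative_eq_0_at_max[OF side.has_velocity])
      fix s
      have "x(j := \<gamma> (side_of j) s) \<in> PiE UNIV C"
        using x by (auto simp: maximal_def C_def PiE_iff)
      with x have "F (x(j := \<gamma> (side_of j) s)) \<le> F x" by (simp add: maximal_def)
      then have "area_form (\<gamma> (side_of j) s) ?w \<le> area_form (\<gamma> (side_of j) t) ?w"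
        by (simp add: update[OF j] t area_form_minus_left)
      then show "vector [?w $ 2, - ?w $ 1] \<bullet> \<gamma> (side_of j) s \<le> vector [?w $ 2, - ?w $ 1] \<bullet> \<gamma> (side_of j) t"
        by (simp add: area_form_eq_inner)
    qed
    then show ?thesis
      unfolding t side.tangent_line using area_form_eq_0_iff side.velocity_nonzero by blast
  qed

  have nondegenerate: "x (succ j) \<noteq> x (pred j)" if x: "maximal x" and j: "j \<in> I" for x j
  proof
    assume eq: "x (succ j) = x (pred j)"
    define m where "m = succ j"
    \<comment> \<open>The condition \<open>succ m \<noteq> j\<close> is where
      \<open>k \<ge> 2\<close> enters: in a closed polygon with only two vertices, the successor of
      \<open>m\<close> would be \<open>j\<close> again.\<close>
    have m: "m \<in> I" "m \<noteq> j" "pred m = j" "succ m \<noteq> j"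
      using j n unfolding m_def by (auto simp: succ_eq pred_eq I_def)
    obtain t where t: "x m = \<gamma> (side_of m) t"
      using on[OF x] by blast
    have "p - x (succ m) \<in> span {side.velocity (side_of m) t}" if p: "p \<in> range (\<gamma> (side_of j))" for p
    proof -
      have "F (x(j := p)) = F x" by (simp add: update[OF j] eq area_form_def)
      moreover have "x(j := p) \<in> PiE UNIV C"
        using x p by (auto simp: maximal_def C_def PiE_iff)
      ultimately have "maximal (x(j := p))" using x by (simp add: maximal_def)
      from critical[OF this m(1)] have "x (succ m) - p \<in> span {side.velocity (side_of m) t}"
        using m by (simp add: t side.tangent_line)
      then show ?thesis by (metis minus_diff_eq span_neg)
    qed
    then show False using side.range_not_in_line by blast
  qed

  have "PiE UNIV C \<noteq> {}" by (auto simp: PiE_eq_empty_iff C_def)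
  moreover have "compact (PiE UNIV C)"
    by (intro compact_PiE_UNIV) (simp add: C_def side.compact_range)
  moreover have "continuous_on (PiE UNIV C) F"
    unfolding F_def
    by (intro continuous_intros continuous_on_subset[OF continuous_on_product_coordinates]) auto
  ultimately obtain x where x: "maximal x"
    unfolding maximal_def by (meson continuous_attains_sup)
  show thesis
  proof (rule that)
    fix i :: int
    \<comment> \<open>Periodic extension of the maximiser. Reducing indices modulo \<open>n\<close>
      preserves their parity because \<open>n\<close> is even, so each vertex stays on the correct
      loop.\<close>
    let ?x = "\<lambda>i. x (i mod n)"
    have I: "i mod n \<in> I" using n by (simp add: I_def)
    have side: "side_of (i mod n) = side_of i"
      using n by (simp add: side_of_def even_iff_mod_2_eq_zero mod_mod_cancel)
    have succ: "succ (i mod n) = (i + 1) mod n" and pred: "pred (i mod n) = (i - 1) mod n"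
      by (simp_all add: succ_def pred_def mod_simps)
    show "?x (i + 2 * k) = ?x i" by (simp add: n_def)
    show "?x i \<in> range (\<gamma> (side_of i))"
      using on[OF x] side by metis
    show "?x (i + 1) \<noteq> ?x (i - 1)"
      using nondegenerate[OF x I] by (simp add: succ pred)
    show "?x (i + 1) - ?x (i - 1) \<in> tangent_line (\<gamma> (side_of i)) (?x i)"
      using critical[OF x I] by (simp add: succ pred side)
  qed
qed

end

theorem theorem6p1:
  fixes \<gamma> :: "sign \<Rightarrow> real \<Rightarrow> real^2" and k :: int
  assumes "strictly_convex_smooth_loop (\<gamma> Minus)"
    and "strictly_convex_smooth_loop (\<gamma> Plus)"
    and "k \<ge> 2"
  shows "\<exists>s x. periodic_billiard_trajectory \<gamma> (2 * k) s x"
proof -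
  interpret convex_loops \<gamma>
  proof
    show "strictly_convex_smooth_loop (\<gamma> s)" for s
      using assms(1,2) by (cases s) auto
  qed
  obtain x where per: "\<And>i. x (i + 2 * k) = x i"
    and x: "\<And>i. x i \<in> range (\<gamma> (side_of i))" "\<And>i. x (i + 1) \<noteq> x (i - 1)"
      "\<And>i. x (i + 1) - x (i - 1) \<in> tangent_line (\<gamma> (side_of i)) (x i)"
    by (rule exists_closed_polygon[OF assms(3)]) (rule that)
  have "billiard_trajectory \<gamma> Minus x"
    using x by (rule billiard_trajectoryI)
  \<comment> \<open>A state consists of two consecutive vertices and a sign: periodicity is used at
    indices 0 and 1, and the sign returns because \<open>2 * k\<close> is even.\<close>
  then have "periodic_billiard_trajectory \<gamma> (2 * k) Minus x"
    using per[of 0] per[of 1]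
    by (simp add: periodic_billiard_trajectory_def billiard_trajectory_def add.commute)
  then show ?thesis by blast
qed

end
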